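(* Let $F$ be an arbitrary field and let $P$ be a Poisson algebra of dimension $2$ over $F$. Then $P$ is isomorphic to exactly one of the following algebras, where in (vi) the quadratic extension is taken up to $F$-algebra isomorphism. (i) $P_{2,1}=Fa\oplus Fb$, where all associative products and all Lie brackets are zero. (ii) $P_{2,2}=Fa\oplus Fb$, where $a^2=b$, and all other associative products and all Lie brackets are zero. (iii) $P_{2,3}=Fe\oplus Fb$, where $e^2=e$, and all other associative products and all Lie brackets are zero. (iv) $P_{2,4}=Fe_1\oplus Fe_2$, where $e_1^2=e_1$, $e_2^2=e_2$, $e_1e_2=0$, and the Lie multiplication is zero. (v) $P_{2,5}=Fe\oplus Fu$, where $e^2=e$, $eu=u$, $u^2=0$, and the Lie multiplication is zero. (vi) $P_{2,6}(E)=E$, where $E/F$ is a quadratic field extension, the associative multiplication is the ordinary multiplication in $E$, and the Lie multiplication is zero. (vii) $P_{2,7}=Fa\oplus Fb$, where $[a,b]=b$, and the associative multiplication is zero. Within (vi), the isomorphism type depends on the $F$-algebra isomorphism class of $E$; with this understood, the listed types are pairwise non-isomorphic.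
   Context: A Poisson algebra over a field $F$ is an $F$-vector space $P$ with two $F$-bilinear operations: a commutative associative multiplication $(x,y)\mapsto xy$ (not assumed to have an identity) and a Lie multiplication $(x,y)\mapsto[x,y]$ (alternating, $[x,x]=0$ for all $x$, and satisfying the Jacobi identity), such that $[xy,z]=x[y,z]+y[x,z]$ for all $x,y,z\in P$. An isomorphism of Poisson algebras is an $F$-linear bijection preserving both multiplications. No restriction on $\operatorname{char}(F)$ is imposed. A quadratic field extension is a field extension of degree $2$. Products and brackets of basis elements that are neither displayed nor determined from the displayed ones by commutativity, bilinearity and alternation are zero. *)

theory Defs
  imports Complex_Main "HOL-Library.Product_Plus"
begin

text \<open>The addition of an algebra comes from the class \<^class>\<open>ab_group_add\<close> on its type;
  the remaining operations are bundled in a record, so that one type can carry several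
  algebras.\<close>

record ('f, 'p) poisson =
  scal :: "'f \<Rightarrow> 'p \<Rightarrow> 'p"
  prd :: "'p \<Rightarrow> 'p \<Rightarrow> 'p"
  brk :: "'p \<Rightarrow> 'p \<Rightarrow> 'p"

locale poisson_algebra = vector_space "scal P"
  for P :: "('f::field, 'p::ab_group_add) poisson" +
  assumes prd_linear_left: "Vector_Spaces.linear (scal P) (scal P) (\<lambda>x. prd P x y)"
    and prd_linear_right: "Vector_Spaces.linear (scal P) (scal P) (\<lambda>y. prd P x y)"
    and prd_assoc: "prd P (prd P x y) z = prd P x (prd P y z)"
    and prd_comm: "prd P x y = prd P y x"
    and brk_linear_left: "Vector_Spaces.linear (scal P) (scal P) (\<lambda>x. brk P x y)"
    and brk_linear_right: "Vector_Spaces.linear (scal P) (scal P) (\<lambda>y. brk P x y)"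
    and brk_alt: "brk P x x = 0"
    and jacobi: "brk P x (brk P y z) + brk P y (brk P z x) + brk P z (brk P x y) = 0"
    and leibniz: "brk P (prd P x y) z = prd P x (brk P y z) + prd P y (brk P x z)"

definition poisson_dim :: "('f::field, 'p::ab_group_add) poisson \<Rightarrow> nat" where
  "poisson_dim P = vector_space.dim (scal P) UNIV"

definition poisson_iso ::
  "('f::field, 'p::ab_group_add) poisson \<Rightarrow> ('f, 'q::ab_group_add) poisson \<Rightarrow> bool"
  (infix "\<simeq>\<^sub>P" 50) where
  "P \<simeq>\<^sub>P Q \<longleftrightarrow> (\<exists>\<phi>. Vector_Spaces.linear (scal P) (scal Q) \<phi> \<and> bij \<phi> \<and>
     (\<forall>x y. \<phi> (prd P x y) = prd Q (\<phi> x) (\<phi> y)) \<and>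
     (\<forall>x y. \<phi> (brk P x y) = brk Q (\<phi> x) (\<phi> y)))"


text \<open>Algebras on \<open>F \<times> F\<close> given by a multiplication table on the basis
  \<open>(1, 0)\<close>, \<open>(0, 1)\<close>. The arguments of \<open>comm_table\<close> are the product of the first basis
  vector with itself, the mixed product, and the product of the second basis vector with
  itself; the argument of \<open>alt_table\<close> is the bracket of the first with the second.\<close>

definition pair_scal :: "'f::field \<Rightarrow> 'f \<times> 'f \<Rightarrow> 'f \<times> 'f" where
  "pair_scal c v = (c * fst v, c * snd v)"

definition comm_table ::
  "'f::field \<times> 'f \<Rightarrow> 'f \<times> 'f \<Rightarrow> 'f \<times> 'f \<Rightarrow> 'f \<times> 'f \<Rightarrow> 'f \<times> 'f \<Rightarrow> 'f \<times> 'f" where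
  "comm_table p11 p12 p22 v w =
     pair_scal (fst v * fst w) p11 + pair_scal (fst v * snd w + snd v * fst w) p12 +
     pair_scal (snd v * snd w) p22"

definition alt_table :: "'f::field \<times> 'f \<Rightarrow> 'f \<times> 'f \<Rightarrow> 'f \<times> 'f \<Rightarrow> 'f \<times> 'f" where
  "alt_table b v w = pair_scal (fst v * snd w - snd v * fst w) b"

definition table_algebra ::
  "'f::field \<times> 'f \<Rightarrow> 'f \<times> 'f \<Rightarrow> 'f \<times> 'f \<Rightarrow> 'f \<times> 'f \<Rightarrow> ('f, 'f \<times> 'f) poisson" where
  "table_algebra p11 p12 p22 b =
     \<lparr>scal = pair_scal, prd = comm_table p11 p12 p22, brk = alt_table b\<rparr>"

definition P21 :: "('f::field, 'f \<times> 'f) poisson" where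
  "P21 = table_algebra 0 0 0 0"

definition P22 :: "('f::field, 'f \<times> 'f) poisson" where
  "P22 = table_algebra (0, 1) 0 0 0"

definition P23 :: "('f::field, 'f \<times> 'f) poisson" where
  "P23 = table_algebra (1, 0) 0 0 0"

definition P24 :: "('f::field, 'f \<times> 'f) poisson" where
  "P24 = table_algebra (1, 0) 0 (0, 1) 0"

definition P25 :: "('f::field, 'f \<times> 'f) poisson" where
  "P25 = table_algebra (1, 0) (0, 1) 0 0"

definition P27 :: "('f::field, 'f \<times> 'f) poisson" where
  "P27 = table_algebra 0 0 0 (0, 1)"


text \<open>Field extensions of \<open>'f\<close>, again with the addition taken from the type. The field
  structure is carried by a record, not by the class \<^class>\<open>field\<close>, so that one can
  quantify over all extensions on a given type. The operations \<open>dv\<close> and \<open>iv\<close> are uniquely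
  determined by the others. Since HOL cannot quantify existentially over types, the
  existence of a quadratic extension with some property is expressed on the type
  \<open>'f \<times> 'f\<close>, which carries a copy of every quadratic extension of \<open>'f\<close>.\<close>

record ('f, 'e) extension =
  emult :: "'e \<Rightarrow> 'e \<Rightarrow> 'e"
  eone :: 'e
  embed :: "'f \<Rightarrow> 'e"

definition ext_scal :: "('f, 'e) extension \<Rightarrow> 'f \<Rightarrow> 'e \<Rightarrow> 'e" where
  "ext_scal E c x = emult E (embed E c) x"

definition field_extension :: "('f::field, 'e::ab_group_add) extension \<Rightarrow> bool" where
  "field_extension E \<longleftrightarrow>
     (\<exists>dv iv. class.field dv iv (emult E) (eone E) (+) 0 (-) uminus) \<and>
     embed E 1 = eone E \<and>
     (\<forall>a b. embed E (a + b) = embed E a + embed E b) \<and>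
     (\<forall>a b. embed E (a * b) = emult E (embed E a) (embed E b))"

definition quadratic_extension :: "('f::field, 'e::ab_group_add) extension \<Rightarrow> bool" where
  "quadratic_extension E \<longleftrightarrow>
     field_extension E \<and> vector_space.dim (ext_scal E) UNIV = 2"

definition extension_iso ::
  "('f::field, 'e::ab_group_add) extension \<Rightarrow> ('f, 'd::ab_group_add) extension \<Rightarrow> bool"
  (infix "\<simeq>\<^sub>E" 50) where
  "E \<simeq>\<^sub>E D \<longleftrightarrow> (\<exists>\<psi>. Vector_Spaces.linear (ext_scal E) (ext_scal D) \<psi> \<and> bij \<psi> \<and>
     (\<forall>x y. \<psi> (emult E x y) = emult D (\<psi> x) (\<psi> y)) \<and> \<psi> (eone E) = eone D)"

definition P26 :: "('f::field, 'e::ab_group_add) extension \<Rightarrow> ('f, 'e) poisson" where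
  "P26 E = \<lparr>scal = ext_scal E, prd = emult E, brk = (\<lambda>x y. 0)\<rparr>"


definition exactly_one :: "bool list \<Rightarrow> bool" where
  "exactly_one bs \<longleftrightarrow> (\<exists>!i. i < length bs \<and> bs ! i)"


text \<open>All the algebras defined above are indeed two-dimensional Poisson algebras.\<close>

lemma vector_space_pair_scal: "vector_space (pair_scal :: 'f::field \<Rightarrow> _)"
  by unfold_locales (auto simp: pair_scal_def algebra_simps)

lemma poisson_dim_table_algebra:
  "poisson_dim (table_algebra p11 p12 p22 b :: ('f::field, 'f \<times> 'f) poisson) = 2"
proof -
  interpret V: vector_space "pair_scal :: 'f \<Rightarrow> _" by (rule vector_space_pair_scal)
  let ?B = "{(1, 0), (0, 1)} :: ('f \<times> 'f) set"
  have fin: "finite ?B" by simp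
  have "V.independent ?B"
  proof (rule V.independent_if_scalars_zero[OF fin])
    fix f :: "'f \<times> 'f \<Rightarrow> 'f" and x
    assume "(\<Sum>x\<in>?B. pair_scal (f x) x) = 0" and x: "x \<in> ?B"
    then have "f (1, 0) = 0 \<and> f (0, 1) = 0"
      by (simp add: pair_scal_def zero_prod_def)
    with x show "f x = 0" by auto
  qed
  moreover have "V.span ?B = UNIV"
  proof -
    have "(u, v) \<in> V.span ?B" for u v
    proof -
      have "(u, v) = pair_scal u (1, 0) + pair_scal v (0, 1)"
        by (simp add: pair_scal_def)
      also have "\<dots> \<in> V.span ?B"
        by (intro V.span_add V.span_scale V.span_base) auto
      finally show ?thesis .
    qed
    then show ?thesis by auto
  qed
  ultimately have "V.dim UNIV = card ?B"
    by (intro V.dim_eq_card) simp_all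
  then show ?thesis by (simp add: poisson_dim_def table_algebra_def)
qed

lemma poisson_algebra_table_algebra:
  fixes p11 p12 p22 b :: "'f::field \<times> 'f"
  assumes "\<And>x y z. comm_table p11 p12 p22 (comm_table p11 p12 p22 x y) z =
      comm_table p11 p12 p22 x (comm_table p11 p12 p22 y z)"
    and "\<And>x y z. alt_table b (comm_table p11 p12 p22 x y) z =
      comm_table p11 p12 p22 x (alt_table b y z) + comm_table p11 p12 p22 y (alt_table b x z)"
  shows "poisson_algebra (table_algebra p11 p12 p22 b)"
proof -
  interpret vector_space "pair_scal :: 'f \<Rightarrow> _" by (rule vector_space_pair_scal)
  show ?thesis
    unfolding poisson_algebra_def poisson_algebra_axioms_def Vector_Spaces.linear_iff
      table_algebra_def poisson.simps
    using assms vector_space_axioms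
    by (auto simp: comm_table_def alt_table_def pair_scal_def zero_prod_def algebra_simps)
qed

lemma poisson_algebra_models:
  "poisson_algebra P21" "poisson_algebra P22" "poisson_algebra P23"
  "poisson_algebra P24" "poisson_algebra P25" "poisson_algebra P27"
  unfolding P21_def P22_def P23_def P24_def P25_def P27_def
  by (rule poisson_algebra_table_algebra;
      simp add: comm_table_def alt_table_def pair_scal_def zero_prod_def algebra_simps)+

lemma poisson_dim_models:
  "poisson_dim P21 = 2" "poisson_dim P22 = 2" "poisson_dim P23 = 2"
  "poisson_dim P24 = 2" "poisson_dim P25 = 2" "poisson_dim P27 = 2"
  by (simp_all add: P21_def P22_def P23_def P24_def P25_def P27_def poisson_dim_table_algebra)

lemma poisson_P26:
  assumes "quadratic_extension E"
  shows "poisson_algebra (P26 E)" "poisson_dim (P26 E) = 2"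
proof -
  obtain dv iv where
    F: "class.field dv iv (emult E) (eone E) (+) 0 (-) uminus"
    and hom: "embed E 1 = eone E"
      "\<And>a b. embed E (a + b) = embed E a + embed E b"
      "\<And>a b. embed E (a * b) = emult E (embed E a) (embed E b)"
    using assms by (auto simp: quadratic_extension_def field_extension_def)
  interpret E: field dv iv "emult E" "eone E" "(+)" 0 "(-)" uminus by (rule F)
  note assoc = E.mult.assoc and comm = E.mult.commute and one = E.mult_1_left
    and dist = E.distrib_right and dist' = E.distrib_left
  have left_comm: "emult E x (emult E y z) = emult E y (emult E x z)" for x y z
    by (metis assoc comm)
  have V: "vector_space (ext_scal E)"
    by unfold_locales (simp_all add: ext_scal_def hom one dist dist' assoc)
  have zero: "emult E x 0 = 0" "emult E 0 x = 0" for x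
    using dist'[of x 0 0] dist[of 0 0 x] by simp_all
  show "poisson_algebra (P26 E)"
    using V
    unfolding poisson_algebra_def poisson_algebra_axioms_def Vector_Spaces.linear_iff
      P26_def poisson.simps
    by (simp add: ext_scal_def dist dist' assoc comm left_comm zero)
  show "poisson_dim (P26 E) = 2"
    using assms by (simp add: poisson_dim_def P26_def quadratic_extension_def)
qed

end

theory Submission
  imports Defs
begin

text \<open>The listed algebras are told apart by properties that survive isomorphism: a nonzero
  bracket, a nonzero product, a nonzero idempotent, an identity, nilpotent elements, zero
  divisors. \<open>poisson_type\<close> turns these into one number, so that disjointness of all the cases
  reduces to computing it once for each model. For quadratic extensions, a Poisson isomorphism
  is the same as an extension isomorphism, because identities are preserved (\<open>P26_iso_iff\<close>).

  For completeness of the list it is enough to find, in a given algebra, a basis with one of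
  the listed multiplication tables (\<open>iso_table_algebra\<close>).

  If the bracket is nonzero, then \<open>[a, b] = b\<close> in some basis, and the Leibniz rule together
  with associativity forces the product to be zero (\<open>iso_P27\<close>). Otherwise the algebra is just a
  commutative associative algebra. Without nonzero idempotents every element is nilpotent, and
  the algebra is null or spanned by \<open>a\<close> and \<open>a\<^sup>2\<close> with \<open>a\<^sup>3 = 0\<close> (\<open>iso_without_idempotent\<close>).
  With a nonzero idempotent \<open>e\<close>, the Peirce decomposition gives a basis \<open>e, f\<close> in which \<open>ef\<close> is \<open>0\<close> or
  \<open>f\<close> (\<open>iso_with_idempotent\<close>). In the first case \<open>f\<^sup>2\<close> is a multiple of \<open>f\<close>,
  so \<open>f\<close> squares to zero or is a multiple of another idempotent. In the second case \<open>e\<close> is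
  an identity and the algebra is \<open>F[X]\<close> modulo a monic quadratic polynomial, which is \<open>F \<times> F\<close>, the
  dual numbers or a field, according as the polynomial has two distinct roots, a double root or
  no root in \<open>F\<close>.\<close>


section \<open>Isomorphisms\<close>

lemma poisson_isoI:
  assumes "vector_space (scal P)" "vector_space (scal Q)" "bij \<phi>"
    "\<And>x y. \<phi> (x + y) = \<phi> x + \<phi> y" "\<And>c x. \<phi> (scal P c x) = scal Q c (\<phi> x)"
    "\<And>x y. \<phi> (prd P x y) = prd Q (\<phi> x) (\<phi> y)" "\<And>x y. \<phi> (brk P x y) = brk Q (\<phi> x) (\<phi> y)"
  shows "P \<simeq>\<^sub>P Q"
  using assms unfolding poisson_iso_def Vector_Spaces.linear_iff by blast

lemma poisson_iso_sym:
  assumes "P \<simeq>\<^sub>P Q"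
  shows "Q \<simeq>\<^sub>P P"
proof -
  obtain \<phi> where \<phi>: "vector_space (scal P)" "vector_space (scal Q)" "bij \<phi>"
    "\<And>x y. \<phi> (x + y) = \<phi> x + \<phi> y" "\<And>c x. \<phi> (scal P c x) = scal Q c (\<phi> x)"
    "\<And>x y. \<phi> (prd P x y) = prd Q (\<phi> x) (\<phi> y)" "\<And>x y. \<phi> (brk P x y) = brk Q (\<phi> x) (\<phi> y)"
    using assms unfolding poisson_iso_def Vector_Spaces.linear_iff by blast
  have inv1: "\<phi> (inv \<phi> y) = y" for y
    using \<open>bij \<phi>\<close> by (simp add: bij_is_surj surj_f_inv_f)
  have inv2: "inv \<phi> y = x" if "y = \<phi> x" for x y
    using \<open>bij \<phi>\<close> that by (simp add: bij_is_inj)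
  show ?thesis
    by (rule poisson_isoI[of _ _ "inv \<phi>"])
      (auto intro!: inv2 simp: \<phi> inv1 bij_imp_bij_inv)
qed

lemma poisson_iso_trans:
  assumes "P \<simeq>\<^sub>P Q" "Q \<simeq>\<^sub>P R"
  shows "P \<simeq>\<^sub>P R"
proof -
  obtain \<phi> where \<phi>: "vector_space (scal P)" "vector_space (scal Q)" "bij \<phi>"
    "\<And>x y. \<phi> (x + y) = \<phi> x + \<phi> y" "\<And>c x. \<phi> (scal P c x) = scal Q c (\<phi> x)"
    "\<And>x y. \<phi> (prd P x y) = prd Q (\<phi> x) (\<phi> y)" "\<And>x y. \<phi> (brk P x y) = brk Q (\<phi> x) (\<phi> y)"
    using assms unfolding poisson_iso_def Vector_Spaces.linear_iff by blast
  obtain \<psi> where \<psi>: "vector_space (scal Q)" "vector_space (scal R)" "bij \<psi>"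
    "\<And>x y. \<psi> (x + y) = \<psi> x + \<psi> y" "\<And>c x. \<psi> (scal Q c x) = scal R c (\<psi> x)"
    "\<And>x y. \<psi> (prd Q x y) = prd R (\<psi> x) (\<psi> y)" "\<And>x y. \<psi> (brk Q x y) = brk R (\<psi> x) (\<psi> y)"
    using assms unfolding poisson_iso_def Vector_Spaces.linear_iff by blast
  show ?thesis
    by (rule poisson_isoI[of _ _ "\<psi> \<circ> \<phi>"]) (auto simp: \<phi> \<psi> bij_comp)
qed


section \<open>The invariant that separates the models\<close>

text \<open>A decision tree of isomorphism-invariant properties. In dimension two its value is the
  position of the isomorphism class of \<open>P\<close> in the classification, counted from \<open>0\<close>. The test
  for nilpotent elements has to precede the one for zero divisors, because \<open>P25\<close> passes both.\<close>

definition poisson_type :: "('f::field, 'p::ab_group_add) poisson \<Rightarrow> nat" where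
  "poisson_type P =
     (if \<exists>x y. brk P x y \<noteq> 0 then 6
      else if \<forall>x y. prd P x y = 0 then 0
      else if \<nexists>e. e \<noteq> 0 \<and> prd P e e = e then 1
      else if \<nexists>u. \<forall>x. prd P u x = x then 2
      else if \<exists>x. x \<noteq> 0 \<and> prd P x x = 0 then 4
      else if \<exists>x y. x \<noteq> 0 \<and> y \<noteq> 0 \<and> prd P x y = 0 then 3
      else 5)"

lemma poisson_type_iso:
  assumes "P \<simeq>\<^sub>P Q"
  shows "poisson_type P = poisson_type Q"
proof -
  obtain \<phi> where "bij \<phi>" and add: "\<And>x y. \<phi> (x + y) = \<phi> x + \<phi> y"
    and prd: "\<And>x y. \<phi> (prd P x y) = prd Q (\<phi> x) (\<phi> y)"
    and brk: "\<And>x y. \<phi> (brk P x y) = brk Q (\<phi> x) (\<phi> y)"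
    using assms unfolding poisson_iso_def Vector_Spaces.linear_iff by blast
  have ex: "(\<exists>y. R y) \<longleftrightarrow> (\<exists>x. R (\<phi> x))" and all: "(\<forall>y. R y) \<longleftrightarrow> (\<forall>x. R (\<phi> x))" for R
    using \<open>bij \<phi>\<close> by (metis bij_pointE)+
  have inj: "\<phi> x = \<phi> y \<longleftrightarrow> x = y" for x y
    using \<open>bij \<phi>\<close> by (simp add: bij_is_inj inj_eq)
  have "\<phi> 0 = 0"
    using add[of 0 0] by simp
  then have zero: "\<phi> x = 0 \<longleftrightarrow> x = 0" for x
    using inj by metis
  show ?thesis
    unfolding poisson_type_def ex[where R = "\<lambda>x. \<exists>y. brk Q x y \<noteq> 0"]
      ex[where R = "\<lambda>y. brk Q (\<phi> _) y \<noteq> 0"]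
      all[where R = "\<lambda>x. \<forall>y. prd Q x y = 0"] all[where R = "\<lambda>y. prd Q (\<phi> _) y = 0"]
      ex[where R = "\<lambda>e. e \<noteq> 0 \<and> prd Q e e = e"]
      ex[where R = "\<lambda>u. \<forall>x. prd Q u x = x"] all[where R = "\<lambda>x. prd Q (\<phi> _) x = x"]
      ex[where R = "\<lambda>x. x \<noteq> 0 \<and> prd Q x x = 0"]
      ex[where R = "\<lambda>x. \<exists>y. x \<noteq> 0 \<and> y \<noteq> 0 \<and> prd Q x y = 0"]
      ex[where R = "\<lambda>y. \<phi> _ \<noteq> 0 \<and> y \<noteq> 0 \<and> prd Q (\<phi> _) y = 0"]
    by (simp only: prd[symmetric] brk[symmetric] zero inj)
qed

lemmas table_simps = table_algebra_def comm_table_def alt_table_def pair_scal_def zero_prod_def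

lemma poisson_type_P21: "poisson_type (P21 :: ('f::field, 'f \<times> 'f) poisson) = 0"
  by (simp add: poisson_type_def P21_def table_simps)

lemma poisson_type_P22: "poisson_type (P22 :: ('f::field, 'f \<times> 'f) poisson) = 1"
proof -
  have "\<exists>x y. prd (P22 :: ('f, 'f \<times> 'f) poisson) x y \<noteq> 0"
    by (intro exI[of _ "(1, 0)"]) (simp add: P22_def table_simps)
  then show ?thesis
    by (auto simp: poisson_type_def P22_def table_simps)
qed

lemma poisson_type_P23: "poisson_type (P23 :: ('f::field, 'f \<times> 'f) poisson) = 2"
proof -
  have 1: "\<exists>e. e \<noteq> 0 \<and> prd (P23 :: ('f, 'f \<times> 'f) poisson) e e = e"
    by (intro exI[of _ "(1, 0)"]) (simp add: P23_def table_simps)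
  have "prd (P23 :: ('f, 'f \<times> 'f) poisson) u (0, 1) \<noteq> (0, 1)" for u
    by (simp add: P23_def table_simps)
  then have 2: "\<nexists>u. \<forall>x. prd (P23 :: ('f, 'f \<times> 'f) poisson) u x = x"
    by blast
  have 3: "\<not> (\<exists>x y. brk (P23 :: ('f, 'f \<times> 'f) poisson) x y \<noteq> 0)"
    by (simp add: P23_def table_simps)
  have 0: "\<not> (\<forall>x y. prd (P23 :: ('f, 'f \<times> 'f) poisson) x y = 0)"
    using 1 by metis
  show ?thesis
    by (simp only: poisson_type_def 0 1 2 3 if_True if_False simp_thms)
qed

lemma poisson_type_P24: "poisson_type (P24 :: ('f::field, 'f \<times> 'f) poisson) = 3"
proof -
  have 1: "\<exists>e. e \<noteq> 0 \<and> prd (P24 :: ('f, 'f \<times> 'f) poisson) e e = e"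
    by (intro exI[of _ "(1, 0)"]) (simp add: P24_def table_simps)
  have 2: "\<exists>u. \<forall>x. prd (P24 :: ('f, 'f \<times> 'f) poisson) u x = x"
    by (intro exI[of _ "(1, 1)"]) (simp add: P24_def table_simps)
  have 3: "\<not> (\<exists>x y. brk (P24 :: ('f, 'f \<times> 'f) poisson) x y \<noteq> 0)"
    by (simp add: P24_def table_simps)
  have 4: "\<not> (\<exists>x. x \<noteq> 0 \<and> prd (P24 :: ('f, 'f \<times> 'f) poisson) x x = 0)"
    by (auto simp: P24_def table_simps)
  have 5: "\<exists>x y. x \<noteq> 0 \<and> y \<noteq> 0 \<and> prd (P24 :: ('f, 'f \<times> 'f) poisson) x y = 0"
    by (intro exI[of _ "(1, 0)"] exI[of _ "(0, 1)"]) (simp add: P24_def table_simps)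
  have 0: "\<not> (\<forall>x y. prd (P24 :: ('f, 'f \<times> 'f) poisson) x y = 0)"
    using 1 by metis
  show ?thesis
    by (simp only: poisson_type_def 0 1 2 3 4 5 if_True if_False simp_thms)
qed

lemma poisson_type_P25: "poisson_type (P25 :: ('f::field, 'f \<times> 'f) poisson) = 4"
proof -
  have 1: "\<exists>e. e \<noteq> 0 \<and> prd (P25 :: ('f, 'f \<times> 'f) poisson) e e = e"
    by (intro exI[of _ "(1, 0)"]) (simp add: P25_def table_simps)
  have 2: "\<exists>u. \<forall>x. prd (P25 :: ('f, 'f \<times> 'f) poisson) u x = x"
    by (intro exI[of _ "(1, 0)"]) (simp add: P25_def table_simps)
  have 3: "\<not> (\<exists>x y. brk (P25 :: ('f, 'f \<times> 'f) poisson) x y \<noteq> 0)"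
    by (simp add: P25_def table_simps)
  have 4: "\<exists>x. x \<noteq> 0 \<and> prd (P25 :: ('f, 'f \<times> 'f) poisson) x x = 0"
    by (intro exI[of _ "(0, 1)"]) (simp add: P25_def table_simps)
  have 0: "\<not> (\<forall>x y. prd (P25 :: ('f, 'f \<times> 'f) poisson) x y = 0)"
    using 1 by metis
  show ?thesis
    by (simp only: poisson_type_def 0 1 2 3 4 if_True if_False simp_thms)
qed

lemma poisson_type_P26:
  assumes "quadratic_extension E"
  shows "poisson_type (P26 E) = 5"
proof -
  obtain dv iv where F: "class.field dv iv (emult E) (eone E) (+) 0 (-) uminus"
    using assms by (auto simp: quadratic_extension_def field_extension_def)
  interpret E: field dv iv "emult E" "eone E" "(+)" 0 "(-)" uminus by (rule F)
  have one: "emult E (eone E) x = x" for x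
    by (rule E.mult_1_left)
  have "eone E \<noteq> 0"
    using E.zero_neq_one by metis
  have 0: "\<not> (\<forall>x y. prd (P26 E) x y = 0)"
    using one \<open>eone E \<noteq> 0\<close> unfolding P26_def poisson.simps by metis
  have 1: "\<exists>e. e \<noteq> 0 \<and> prd (P26 E) e e = e"
    using one \<open>eone E \<noteq> 0\<close> unfolding P26_def poisson.simps by metis
  have 2: "\<exists>u. \<forall>x. prd (P26 E) u x = x"
    using one unfolding P26_def poisson.simps by metis
  have 3: "\<not> (\<exists>x y. brk (P26 E) x y \<noteq> 0)"
    by (simp add: P26_def)
  have 4: "\<not> (\<exists>x. x \<noteq> 0 \<and> prd (P26 E) x x = 0)"
    using E.no_zero_divisors unfolding P26_def poisson.simps by metis
  have 5: "\<not> (\<exists>x y. x \<noteq> 0 \<and> y \<noteq> 0 \<and> prd (P26 E) x y = 0)"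
    using E.no_zero_divisors unfolding P26_def poisson.simps by metis
  show ?thesis
    by (simp only: poisson_type_def 0 1 2 3 4 5 if_True if_False simp_thms)
qed

lemma poisson_type_P27: "poisson_type (P27 :: ('f::field, 'f \<times> 'f) poisson) = 6"
proof -
  have "\<exists>x y. brk (P27 :: ('f, 'f \<times> 'f) poisson) x y \<noteq> 0"
    by (intro exI[of _ "(1, 0)"] exI[of _ "(0, 1)"]) (simp add: P27_def table_simps)
  then show ?thesis
    by (simp add: poisson_type_def)
qed

lemmas poisson_type_models = poisson_type_P21 poisson_type_P22 poisson_type_P23
  poisson_type_P24 poisson_type_P25 poisson_type_P27


section \<open>Isomorphisms of quadratic extensions\<close>

text \<open>A Poisson isomorphism is not required to preserve the identity, but it does so because the
  image of the identity is neutral for every element of the image.\<close>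

lemma P26_iso_iff:
  assumes E: "quadratic_extension E" and D: "quadratic_extension D"
  shows "P26 E \<simeq>\<^sub>P P26 D \<longleftrightarrow> E \<simeq>\<^sub>E D"
proof
  obtain dv iv where F: "class.field dv iv (emult E) (eone E) (+) 0 (-) uminus"
    using E by (auto simp: quadratic_extension_def field_extension_def)
  interpret E: field dv iv "emult E" "eone E" "(+)" 0 "(-)" uminus by (rule F)
  obtain dv' iv' where F': "class.field dv' iv' (emult D) (eone D) (+) 0 (-) uminus"
    using D by (auto simp: quadratic_extension_def field_extension_def)
  interpret D: field dv' iv' "emult D" "eone D" "(+)" 0 "(-)" uminus by (rule F')
  assume "P26 E \<simeq>\<^sub>P P26 D"
  then obtain \<phi> where \<phi>: "Vector_Spaces.linear (ext_scal E) (ext_scal D) \<phi>" "bij \<phi>"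
    "\<And>x y. \<phi> (emult E x y) = emult D (\<phi> x) (\<phi> y)"
    by (auto simp: poisson_iso_def P26_def)
  obtain x where x: "\<phi> x = eone D"
    using \<open>bij \<phi>\<close> by (metis bij_pointE)
  have "eone D = \<phi> (emult E (eone E) x)"
    using x E.mult_1_left by simp
  also have "\<dots> = \<phi> (eone E)"
    by (simp only: \<phi>(3) x D.mult_1_right)
  finally show "E \<simeq>\<^sub>E D"
    using \<phi> unfolding extension_iso_def by auto
next
  assume "E \<simeq>\<^sub>E D"
  then obtain \<psi> where \<psi>: "Vector_Spaces.linear (ext_scal E) (ext_scal D) \<psi>" "bij \<psi>"
    "\<And>x y. \<psi> (emult E x y) = emult D (\<psi> x) (\<psi> y)"
    by (auto simp: extension_iso_def)
  then have "\<psi> 0 = 0"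
    unfolding Vector_Spaces.linear_iff by (metis add_cancel_right_left)
  with \<psi> show "P26 E \<simeq>\<^sub>P P26 D"
    by (auto simp: poisson_iso_def P26_def)
qed


section \<open>Multiplication tables\<close>

definition comb :: "('f::field, 'p::ab_group_add) poisson \<Rightarrow> 'p \<Rightarrow> 'p \<Rightarrow> 'f \<times> 'f \<Rightarrow> 'p" where
  "comb P a b v = scal P (fst v) a + scal P (snd v) b"

definition indep_pair :: "('f::field, 'p::ab_group_add) poisson \<Rightarrow> 'p \<Rightarrow> 'p \<Rightarrow> bool" where
  "indep_pair P a b \<longleftrightarrow> (\<forall>v. comb P a b v = 0 \<longrightarrow> v = 0)"

context poisson_algebra
begin

abbreviation smul (infixr "\<cdot>" 75) where "c \<cdot> x \<equiv> scal P c x"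
abbreviation assoc_mult (infixl "\<bullet>" 70) where "x \<bullet> y \<equiv> prd P x y"
abbreviation lie_mult ("\<lbrace>_, _\<rbrace>") where "\<lbrace>x, y\<rbrace> \<equiv> brk P x y"

lemma prd_add: "(x + y) \<bullet> z = x \<bullet> z + y \<bullet> z" "z \<bullet> (x + y) = z \<bullet> x + z \<bullet> y"
  and prd_scale: "(c \<cdot> x) \<bullet> z = c \<cdot> (x \<bullet> z)" "z \<bullet> (c \<cdot> x) = c \<cdot> (z \<bullet> x)"
  using prd_linear_left prd_linear_right unfolding Vector_Spaces.linear_iff by blast+

lemma brk_add: "\<lbrace>x + y, z\<rbrace> = \<lbrace>x, z\<rbrace> + \<lbrace>y, z\<rbrace>" "\<lbrace>z, x + y\<rbrace> = \<lbrace>z, x\<rbrace> + \<lbrace>z, y\<rbrace>"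
  and brk_scale: "\<lbrace>c \<cdot> x, z\<rbrace> = c \<cdot> \<lbrace>x, z\<rbrace>" "\<lbrace>z, c \<cdot> x\<rbrace> = c \<cdot> \<lbrace>z, x\<rbrace>"
  using brk_linear_left brk_linear_right unfolding Vector_Spaces.linear_iff by blast+

lemma prd_zero [simp]: "0 \<bullet> x = 0" "x \<bullet> 0 = 0"
  using prd_add(1)[of 0 0 x] prd_add(2)[of x 0 0] by simp_all

lemma prd_diff: "(x - y) \<bullet> z = x \<bullet> z - y \<bullet> z" "z \<bullet> (x - y) = z \<bullet> x - z \<bullet> y"
  using prd_add(1)[of "x - y" y z] prd_add(2)[of z "x - y" y] by simp_all

lemma brk_zero [simp]: "\<lbrace>0, x\<rbrace> = 0" "\<lbrace>x, 0\<rbrace> = 0"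
  using brk_add(1)[of 0 0 x] brk_add(2)[of x 0 0] by simp_all

lemma brk_anticomm: "\<lbrace>y, x\<rbrace> = - \<lbrace>x, y\<rbrace>"
proof -
  have "\<lbrace>x + y, x + y\<rbrace> = \<lbrace>y, x\<rbrace> + \<lbrace>x, y\<rbrace>"
    unfolding brk_add by (simp add: brk_alt add.commute)
  then show ?thesis
    unfolding brk_alt by (simp add: eq_neg_iff_add_eq_0)
qed


lemma indep_pairI:
  assumes "a \<noteq> 0" "\<And>c. b \<noteq> c \<cdot> a"
  shows "indep_pair P a b"
  unfolding indep_pair_def
proof (intro allI impI)
  fix v
  assume v: "comb P a b v = 0"
  have "snd v = 0"
  proof (rule ccontr)
    assume nz: "snd v \<noteq> 0"
    have "snd v \<cdot> b = - (fst v \<cdot> a)"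
      using v by (simp add: comb_def eq_neg_iff_add_eq_0 add.commute)
    then have "(1 / snd v) \<cdot> (snd v \<cdot> b) = (- fst v / snd v) \<cdot> a"
      by simp
    then show False
      using nz assms(2)[of "- fst v / snd v"] by simp
  qed
  with v \<open>a \<noteq> 0\<close> show "v = 0"
    by (simp add: comb_def prod_eq_iff)
qed

lemma indep_pairD:
  assumes "indep_pair P a b" "c \<cdot> a + d \<cdot> b = 0"
  shows "c = 0" "d = 0"
  using assms unfolding indep_pair_def comb_def
  by (metis fst_conv snd_conv zero_prod_def)+

lemma indep_pair_nonzero:
  assumes "indep_pair P a b"
  shows "a \<noteq> 0" "b \<noteq> 0"
  using indep_pairD[OF assms, of 1 0] indep_pairD[OF assms, of 0 1] by auto

lemma comb_diff: "comb P a b v - comb P a b w = comb P a b (v - w)"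
  by (simp add: comb_def scale_left_diff_distrib)

lemma prd_comb:
  assumes "a \<bullet> a = comb P a b p11" "a \<bullet> b = comb P a b p12" "b \<bullet> b = comb P a b p22"
  shows "comb P a b v \<bullet> comb P a b w = comb P a b (comm_table p11 p12 p22 v w)"
proof -
  have "b \<bullet> a = comb P a b p12"
    using assms(2) prd_comm by metis
  with assms show ?thesis
    by (simp add: comb_def comm_table_def pair_scal_def prd_add prd_scale
        scale_left_distrib scale_right_distrib algebra_simps)
qed

lemma brk_comb:
  assumes "\<lbrace>a, b\<rbrace> = comb P a b \<beta>"
  shows "\<lbrace>comb P a b v, comb P a b w\<rbrace> = comb P a b (alt_table \<beta> v w)"
proof -
  have "\<lbrace>comb P a b v, comb P a b w\<rbrace> = (fst v * snd w) \<cdot> \<lbrace>a, b\<rbrace> + (snd v * fst w) \<cdot> \<lbrace>b, a\<rbrace>"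
    by (simp add: comb_def brk_add brk_scale brk_alt mult.commute)
  also have "\<dots> = (fst v * snd w - snd v * fst w) \<cdot> \<lbrace>a, b\<rbrace>"
    unfolding brk_anticomm[of a b] by (simp add: scale_left_diff_distrib)
  also have "\<dots> = comb P a b (alt_table \<beta> v w)"
    by (simp add: assms comb_def alt_table_def pair_scal_def scale_right_distrib)
  finally show ?thesis .
qed

end

locale poisson_plane = poisson_algebra +
  assumes dim2: "poisson_dim P = 2"
begin

lemma finite_basis:
  obtains B where "finite B" "independent B" "span B = UNIV" "card B = 2"
proof -
  obtain B where "independent B" and span: "UNIV \<subseteq> span B" and card: "card B = dim UNIV"
    by (rule basis_exists[of UNIV])
  have "card B = 2"
    using card dim2 by (simp add: poisson_dim_def)
  moreover from this have "finite B"
    by (intro card_ge_0_finite) simp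
  moreover have "span B = UNIV"
    using span by (intro top.extremum_uniqueI)
  ultimately show thesis
    using \<open>independent B\<close> that by blast
qed

lemma indep_pair_spans:
  assumes "indep_pair P a b"
  obtains v where "x = comb P a b v"
proof -
  have ab: "a \<noteq> b"
    using indep_pairD[OF assms, of 1 "-1"] by auto
  have "independent {a, b}"
  proof (rule independent_if_scalars_zero)
    fix f x
    assume "(\<Sum>x\<in>{a, b}. f x \<cdot> x) = 0" "x \<in> {a, b}"
    then show "f x = 0"
      using ab indep_pairD[OF assms, of "f a" "f b"] by auto
  qed simp
  have "x \<in> span {a, b}"
  proof (rule ccontr)
    assume x: "x \<notin> span {a, b}"
    then have "independent (insert x {a, b})"
      using \<open>independent {a, b}\<close> independent_insertI by blast
    moreover obtain B where "finite B" "span B = UNIV" "card B = 2"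
      by (rule finite_basis)
    ultimately have "card (insert x {a, b}) \<le> 2"
      using independent_span_bound[of B "insert x {a, b}"] by auto
    moreover have "x \<notin> {a, b}"
      using x span_base by blast
    ultimately show False
      using ab by simp
  qed
  then obtain c d where "x - c \<cdot> a - d \<cdot> b = 0"
    by (auto simp: span_breakdown_eq)
  then have "x = comb P a b (c, d)"
    by (simp add: comb_def algebra_simps)
  then show thesis
    by (rule that)
qed

lemma indep_pair_exists:
  obtains a b where "indep_pair P a b"
proof -
  obtain B where B: "independent B" "card B = 2"
    by (rule finite_basis)
  then obtain a b where ab: "B = {a, b}" "a \<noteq> b"
    by (auto simp: card_2_iff)
  have "indep_pair P a b"
    unfolding indep_pair_def
  proof (intro allI impI)
    fix v
    assume "comb P a b v = 0"
    then have sum: "(\<Sum>x\<in>B. (if x = a then fst v else snd v) \<cdot> x) = 0"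
      using ab by (simp add: comb_def)
    show "v = 0"
      using independentD[OF \<open>independent B\<close> _ order_refl sum, of a]
        independentD[OF \<open>independent B\<close> _ order_refl sum, of b] ab
      by (auto simp: prod_eq_iff)
  qed
  then show thesis
    by (rule that)
qed

lemma indep_pair_extend:
  assumes "a \<noteq> 0"
  obtains b where "indep_pair P a b"
proof -
  obtain p q where pq: "indep_pair P p q"
    by (rule indep_pair_exists)
  have "\<exists>b. \<forall>c. b \<noteq> c \<cdot> a"
  proof (rule ccontr)
    assume "\<not> ?thesis"
    then obtain c d where cd: "p = c \<cdot> a" "q = d \<cdot> a"
      by metis
    then have "d \<cdot> p + (- c) \<cdot> q = 0"
      by (simp add: mult.commute)
    then have "c = 0"
      using indep_pairD[OF pq] by fastforce
    then show False
      using indep_pair_nonzero[OF pq] cd by simp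
  qed
  then show thesis
    using that indep_pairI[OF assms] by metis
qed

text \<open>By bilinearity, the coordinate map of a basis respects both multiplications as soon as it
  does so on the basis. Recognising an algebra thus amounts to finding a suitable basis.\<close>

lemma iso_table_algebra:
  assumes ind: "indep_pair P a b"
    and "a \<bullet> a = comb P a b p11" "a \<bullet> b = comb P a b p12" "b \<bullet> b = comb P a b p22"
    and "\<lbrace>a, b\<rbrace> = comb P a b \<beta>"
  shows "P \<simeq>\<^sub>P table_algebra p11 p12 p22 \<beta>"
proof (rule poisson_iso_sym, rule poisson_isoI[of _ _ "comb P a b"])
  show "vector_space (scal (table_algebra p11 p12 p22 \<beta>))"
    using vector_space_pair_scal by (simp add: table_algebra_def)
  show "vector_space (scal P)"
    by unfold_locales
  have "inj (comb P a b)"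
  proof (rule injI)
    fix v w
    assume "comb P a b v = comb P a b w"
    then have "comb P a b (v - w) = 0"
      by (simp flip: comb_diff)
    then show "v = w"
      using ind unfolding indep_pair_def by (metis eq_iff_diff_eq_0)
  qed
  moreover have "surj (comb P a b)"
    unfolding surj_def
  proof
    show "\<exists>v. x = comb P a b v" for x
      by (rule indep_pair_spans[OF ind]) blast
  qed
  ultimately show "bij (comb P a b)"
    by (simp add: bij_def)
  show "comb P a b (v + w) = comb P a b v + comb P a b w" for v w
    by (simp add: comb_def scale_left_distrib algebra_simps)
  show "comb P a b (scal (table_algebra p11 p12 p22 \<beta>) c v) = c \<cdot> comb P a b v" for c v
    by (simp add: comb_def table_algebra_def pair_scal_def scale_right_distrib)
  show "comb P a b (prd (table_algebra p11 p12 p22 \<beta>) v w) = comb P a b v \<bullet> comb P a b w" for v w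
    using assms by (simp add: prd_comb table_algebra_def)
  show "comb P a b (brk (table_algebra p11 p12 p22 \<beta>) v w) = \<lbrace>comb P a b v, comb P a b w\<rbrace>" for v w
    using assms by (simp add: brk_comb table_algebra_def)
qed


section \<open>Nonzero bracket\<close>

text \<open>All brackets are multiples of one vector \<open>b\<close>, given by a nondegenerate alternating form,
  so some \<open>a\<close> has \<open>\<lbrace>a, b\<rbrace> = b\<close>. The Leibniz rule then gives \<open>ab = kb\<close>, \<open>b\<^sup>2 = 0\<close> and
  \<open>a\<^sup>2 = 2ka\<close>. Comparing \<open>(aa)b = 2k\<^sup>2b\<close> with \<open>a(ab) = k\<^sup>2b\<close> yields \<open>k = 0\<close>.\<close>

lemma iso_P27:
  assumes "\<lbrace>x, y\<rbrace> \<noteq> 0"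
  shows "P \<simeq>\<^sub>P P27"
proof -
  obtain p q where pq: "indep_pair P p q"
    by (rule indep_pair_exists)
  obtain \<beta> where \<beta>: "\<lbrace>p, q\<rbrace> = comb P p q \<beta>"
    using indep_pair_spans[OF pq] by metis
  define b where "b = \<lbrace>p, q\<rbrace>"
  have "b \<noteq> 0"
  proof
    assume "b = 0"
    obtain v w where "x = comb P p q v" "y = comb P p q w"
      using indep_pair_spans[OF pq] by metis
    then show False
      using assms brk_comb[of p q 0] \<open>b = 0\<close>
      by (simp add: b_def alt_table_def pair_scal_def comb_def)
  qed
  have "\<exists>a. \<lbrace>a, b\<rbrace> = b"
  proof (cases "snd \<beta> = 0")
    case False
    have "\<lbrace>p, b\<rbrace> = snd \<beta> \<cdot> b"
      using \<beta> by (simp add: b_def comb_def brk_add brk_scale brk_alt)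
    then have "\<lbrace>(1 / snd \<beta>) \<cdot> p, b\<rbrace> = b"
      using False by (simp add: brk_scale)
    then show ?thesis ..
  next
    case True
    then have "fst \<beta> \<noteq> 0"
      using \<open>b \<noteq> 0\<close> \<beta> by (auto simp: b_def comb_def)
    have "b = fst \<beta> \<cdot> p"
      using \<beta> True by (simp add: b_def comb_def)
    then have "\<lbrace>q, b\<rbrace> = fst \<beta> \<cdot> \<lbrace>q, p\<rbrace>"
      by (simp add: brk_scale)
    also have "\<dots> = - (fst \<beta> \<cdot> b)"
      using brk_anticomm[of p q] by (simp add: b_def)
    finally have "\<lbrace>q, b\<rbrace> = - (fst \<beta> \<cdot> b)" .
    then have "(- 1 / fst \<beta>) \<cdot> \<lbrace>q, b\<rbrace> = b"
      using \<open>fst \<beta> \<noteq> 0\<close> by simp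
    then have "\<lbrace>(- 1 / fst \<beta>) \<cdot> q, b\<rbrace> = b"
      by (simp only: brk_scale)
    then show ?thesis ..
  qed
  then obtain a where ab: "\<lbrace>a, b\<rbrace> = b"
    by blast
  have ba: "\<lbrace>b, a\<rbrace> = - b"
    using ab brk_anticomm by metis
  have ind: "indep_pair P a b"
    unfolding indep_pair_def
  proof (intro allI impI)
    fix v
    assume v: "comb P a b v = 0"
    then have "\<lbrace>comb P a b v, b\<rbrace> = 0"
      by simp
    then have "fst v = 0"
      using \<open>b \<noteq> 0\<close> by (simp add: comb_def brk_add brk_scale brk_alt ab)
    with v \<open>b \<noteq> 0\<close> show "v = 0"
      by (simp add: comb_def prod_eq_iff)
  qed
  \<comment> \<open>By the Leibniz rule \<open>a \<bullet> b\<close> lies in the eigenspace of \<open>\<lbrace>_, a\<rbrace>\<close> for \<open>-1\<close>, which is spanned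
    by \<open>b\<close>.\<close>
  obtain k where k: "a \<bullet> b = k \<cdot> b"
  proof -
    obtain v where v: "a \<bullet> b = comb P a b v"
      using indep_pair_spans[OF ind] by metis
    have "\<lbrace>a \<bullet> b, a\<rbrace> = - (a \<bullet> b)"
      using leibniz[of a b a] ba prd_scale(2)[of a "-1" b] by (simp add: brk_alt)
    then have "fst v \<cdot> a + 0 \<cdot> b = 0"
      using v ba by (simp add: comb_def brk_add brk_scale brk_alt)
    then have "fst v = 0"
      by (rule indep_pairD[OF ind])
    then have "a \<bullet> b = snd v \<cdot> b"
      using v by (simp add: comb_def)
    then show thesis
      by (rule that)
  qed
  have bb: "b \<bullet> b = 0"
    using leibniz[of a b b] ab k by (simp add: brk_alt brk_scale)
  \<comment> \<open>The bracket of \<open>a \<bullet> a\<close> with \<open>a\<close> vanishes, so \<open>a \<bullet> a\<close> is a multiple of \<open>a\<close>.\<close>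
  obtain m where m: "a \<bullet> a = m \<cdot> a"
  proof -
    obtain v where v: "a \<bullet> a = comb P a b v"
      using indep_pair_spans[OF ind] by metis
    have "\<lbrace>a \<bullet> a, a\<rbrace> = 0"
      using leibniz[of a a a] by (simp add: brk_alt)
    then have "snd v = 0"
      using v ba \<open>b \<noteq> 0\<close> by (simp add: comb_def brk_add brk_scale brk_alt)
    then have "a \<bullet> a = fst v \<cdot> a"
      using v by (simp add: comb_def)
    then show thesis
      by (rule that)
  qed
  have "m \<cdot> b = k \<cdot> b + k \<cdot> b"
    using leibniz[of a a b] ab k m by (simp add: brk_scale)
  then have "m \<cdot> b = (k + k) \<cdot> b"
    by (simp only: scale_left_distrib)
  then have mk: "m = k + k"
    using \<open>b \<noteq> 0\<close> by (simp only: scale_cancel_right simp_thms)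
  have "(m * k) \<cdot> b = (k * k) \<cdot> b"
    using prd_assoc[of a a b] k m by (simp add: prd_scale)
  then have "m * k = k * k"
    using \<open>b \<noteq> 0\<close> by simp
  with mk have "k * k + k * k = k * k"
    by (simp only: distrib_right)
  then have "k = 0"
    using add_cancel_right_right mult_eq_0_iff by metis
  with mk have "m = 0"
    by simp
  show ?thesis
    unfolding P27_def
    by (rule iso_table_algebra[OF ind])
      (simp_all add: comb_def k m bb ab \<open>k = 0\<close> \<open>m = 0\<close>)
qed


section \<open>Zero bracket, no idempotent\<close>

text \<open>Suppose first that \<open>a\<close> and \<open>a\<^sup>2\<close> are independent and \<open>a\<^sup>3 = \<lambda>a + \<mu>a\<^sup>2\<close>. If \<open>\<lambda> \<noteq> 0\<close> then
  \<open>(a\<^sup>2 - \<mu>a) / \<lambda>\<close> fixes \<open>a\<close> and is idempotent; if \<open>\<lambda> = 0 \<noteq> \<mu>\<close> then \<open>a\<^sup>2 / \<mu>\<^sup>2\<close> is idempotent. So only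
  \<open>a\<^sup>3 = 0\<close> remains. If no such \<open>a\<close> exists, every square is zero, since \<open>x\<^sup>2 = cx\<close> with \<open>c \<noteq> 0\<close>
  makes \<open>x / c\<close> idempotent. Polarising \<open>(a + b)\<^sup>2 = 0\<close> would only give \<open>2ab = 0\<close>; instead, if
  \<open>ab = pa + qb\<close> then \<open>q(ab) = a(ab) = a\<^sup>2b = 0\<close> and likewise \<open>p(ab) = 0\<close>, so \<open>ab = 0\<close>.\<close>

lemma iso_without_idempotent:
  assumes brk: "\<And>x y. \<lbrace>x, y\<rbrace> = 0" and idem: "\<And>e. e \<bullet> e = e \<Longrightarrow> e = 0"
  shows "P \<simeq>\<^sub>P P21 \<or> P \<simeq>\<^sub>P P22"
proof (cases "\<exists>a. indep_pair P a (a \<bullet> a)")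
  case True
  then obtain a b where ind: "indep_pair P a b" and b: "a \<bullet> a = b"
    by blast
  have nz: "a \<noteq> 0" "b \<noteq> 0"
    using indep_pair_nonzero[OF ind] by auto
  have ba: "b \<bullet> a = a \<bullet> b"
    by (rule prd_comm)
  obtain v where v: "a \<bullet> b = comb P a b v"
    using indep_pair_spans[OF ind] by metis
  define l m where "l = fst v" "m = snd v"
  have cube: "a \<bullet> b = l \<cdot> a + m \<cdot> b"
    using v by (simp add: comb_def l_m_def)
  have "l = 0"
  proof (rule ccontr)
    assume "l \<noteq> 0"
    define e where "e = (1 / l) \<cdot> (b - m \<cdot> a)"
    have ea: "e \<bullet> a = a"
      using \<open>l \<noteq> 0\<close> by (simp add: e_def prd_scale prd_diff ba cube b)
    have eb: "e \<bullet> b = b"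
      using prd_assoc[of e a a] unfolding ea b by (rule sym)
    have "e \<bullet> ((1 / l) \<cdot> (b - m \<cdot> a)) = (1 / l) \<cdot> (b - m \<cdot> a)"
      by (simp only: prd_scale prd_diff ea eb)
    then have "e \<bullet> e = e"
      by (simp only: e_def[symmetric])
    then have "e = 0"
      by (rule idem)
    then show False
      using ea nz by simp
  qed
  have bb: "b \<bullet> b = (m * m) \<cdot> b"
    using prd_assoc[of a a b] \<open>l = 0\<close> by (simp add: b cube prd_scale)
  have "m = 0"
  proof (rule ccontr)
    assume "m \<noteq> 0"
    then have "(1 / (m * m)) \<cdot> b = 0"
      by (intro idem) (simp add: prd_scale bb)
    then show False
      using \<open>m \<noteq> 0\<close> nz by simp
  qed
  have "P \<simeq>\<^sub>P P22"
    unfolding P22_def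
    by (rule iso_table_algebra[OF ind])
      (simp_all add: comb_def b cube bb brk \<open>l = 0\<close> \<open>m = 0\<close>)
  then show ?thesis ..
next
  case False
  have sq: "x \<bullet> x = 0" for x
  proof (cases "x = 0")
    case False
    then obtain c where c: "x \<bullet> x = c \<cdot> x"
      using \<open>\<nexists>a. indep_pair P a (a \<bullet> a)\<close> indep_pairI by blast
    have "c = 0"
    proof (rule ccontr)
      assume "c \<noteq> 0"
      then have "(1 / c) \<cdot> x = 0"
        by (intro idem) (simp add: prd_scale c)
      then show False
        using \<open>c \<noteq> 0\<close> \<open>x \<noteq> 0\<close> by simp
    qed
    then show ?thesis
      using c by simp
  qed simp
  obtain a b where ind: "indep_pair P a b"
    by (rule indep_pair_exists)
  obtain v where v: "a \<bullet> b = comb P a b v"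
    using indep_pair_spans[OF ind] by metis
  have "a \<bullet> (a \<bullet> b) = 0" "(a \<bullet> b) \<bullet> b = 0"
    using prd_assoc[of a a b] prd_assoc[of a b b] by (simp_all add: sq)
  then have "snd v \<cdot> (a \<bullet> b) = 0" "fst v \<cdot> (a \<bullet> b) = 0"
    using v by (simp_all add: comb_def prd_add prd_scale sq)
  then have "a \<bullet> b = 0"
    using v by (auto simp: comb_def)
  then have "P \<simeq>\<^sub>P P21"
    unfolding P21_def
    by (intro iso_table_algebra[OF ind]) (simp_all add: comb_def sq brk)
  then show ?thesis ..
qed

end


section \<open>Quadratic algebras\<close>

text \<open>The algebra \<open>F[X] / (X\<^sup>2 - \<beta>X - \<alpha>)\<close> on the basis \<open>1, X\<close>, with zero bracket.\<close>

definition quadratic_algebra :: "'f::field \<Rightarrow> 'f \<Rightarrow> ('f, 'f \<times> 'f) poisson" where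
  "quadratic_algebra \<alpha> \<beta> = table_algebra (1, 0) (0, 1) (\<alpha>, \<beta>) 0"

lemma quadratic_mult:
  "comm_table (1, 0) (0, 1) (\<alpha>, \<beta>) v w =
     (fst v * fst w + \<alpha> * (snd v * snd w), fst v * snd w + snd v * fst w + \<beta> * (snd v * snd w))"
  by (simp add: comm_table_def pair_scal_def algebra_simps)

lemma quadratic_mult_assoc:
  "comm_table (1, 0) (0, 1) (\<alpha>, \<beta>) (comm_table (1, 0) (0, 1) (\<alpha>, \<beta>) v w) z =
     comm_table (1, 0) (0, 1) (\<alpha>, \<beta>) v (comm_table (1, 0) (0, 1) (\<alpha>, \<beta>) w z)"
  by (simp add: quadratic_mult algebra_simps)

lemma poisson_plane_quadratic_algebra: "poisson_plane (quadratic_algebra \<alpha> \<beta>)"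
proof -
  have "poisson_algebra (quadratic_algebra \<alpha> \<beta>)"
    unfolding quadratic_algebra_def
    by (rule poisson_algebra_table_algebra)
      (simp_all add: quadratic_mult_assoc, simp add: quadratic_mult alt_table_def pair_scal_def zero_prod_def)
  then show ?thesis
    by (simp add: poisson_plane_def poisson_plane_axioms_def quadratic_algebra_def
        poisson_dim_table_algebra)
qed

text \<open>Write \<open>f\<close> for the generator and \<open>r\<close>, \<open>r + t\<close> for the roots. If \<open>t = 0\<close> then \<open>f - r\<close> squares
  to zero. Otherwise the Lagrange interpolation elements \<open>(f - r) / t\<close> and \<open>1 - (f - r) / t\<close>
  are the orthogonal idempotents of the Chinese remainder theorem.\<close>

lemma quadratic_algebra_root:
  assumes "r * r = \<beta> * r + \<alpha>"
  shows "quadratic_algebra \<alpha> \<beta> \<simeq>\<^sub>P P24 \<or> quadratic_algebra \<alpha> \<beta> \<simeq>\<^sub>P P25"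
proof -
  interpret poisson_plane "quadratic_algebra \<alpha> \<beta>"
    by (rule poisson_plane_quadratic_algebra)
  define t where "t = \<beta> - r - r"
  have \<beta>: "\<beta> = r + r + t"
    by (simp add: t_def)
  have \<alpha>: "\<alpha> = - (r * (r + t))"
    using assms by (simp add: t_def algebra_simps)
  let ?Q = "quadratic_algebra \<alpha> \<beta>"
  have prd: "prd ?Q (x, y) (z, w) = (x * z + \<alpha> * (y * w), x * w + y * z + \<beta> * (y * w))"
    and brk: "brk ?Q v w' = 0"
    and comb: "comb ?Q (x, y) (z, w) v = (fst v * x + snd v * z, fst v * y + snd v * w)"
    for x y z w v w'
    by (simp_all add: quadratic_algebra_def table_algebra_def comb_def quadratic_mult
        alt_table_def pair_scal_def zero_prod_def)
  show ?thesis
  proof (cases "t = 0")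
    case True
    have "indep_pair ?Q (1, 0) (- r, 1)"
      by (simp add: indep_pair_def comb zero_prod_def)
    moreover have "prd ?Q (- r, 1) (- r, 1) = 0"
      unfolding prd by (simp add: \<alpha> \<beta> True zero_prod_def)
    moreover have "prd ?Q (1, 0) w = w" for w
      by (cases w) (simp add: prd)
    ultimately have "?Q \<simeq>\<^sub>P P25"
      unfolding P25_def
      by (intro iso_table_algebra[of "(1, 0)" "(- r, 1)"])
        (simp_all add: brk comb zero_prod_def)
    then show ?thesis ..
  next
    case False
    define k where "k = 1 / t"
    have k: "t * k = 1"
      using False by (simp add: k_def)
    define e\<^sub>1 e\<^sub>2 where "e\<^sub>1 = (- (r * k), k)" "e\<^sub>2 = (1 + r * k, - k)"
    note e = e\<^sub>1_e\<^sub>2_def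
    have "indep_pair ?Q e\<^sub>1 e\<^sub>2"
      unfolding indep_pair_def e comb zero_prod_def
    proof (intro allI impI)
      fix v
      assume "(fst v * - (r * k) + snd v * (1 + r * k), fst v * k + snd v * - k) = (0, 0)"
      then have 1: "fst v * - (r * k) + snd v * (1 + r * k) = 0"
        and 2: "fst v * k + snd v * - k = 0"
        by simp_all
      from 2 k have eq: "fst v = snd v"
        by algebra
      with 1 show "v = (0, 0)"
        by (simp add: prod_eq_iff algebra_simps)
    qed
    moreover have "prd ?Q e\<^sub>1 e\<^sub>1 = e\<^sub>1" "prd ?Q e\<^sub>1 e\<^sub>2 = 0" "prd ?Q e\<^sub>2 e\<^sub>2 = e\<^sub>2"
      unfolding e prd unfolding \<alpha> \<beta> zero_prod_def prod.inject using k by (safe; algebra)+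
    ultimately have "?Q \<simeq>\<^sub>P P24"
      unfolding P24_def
      by (intro iso_table_algebra[of e\<^sub>1 e\<^sub>2])
        (simp_all add: brk e comb zero_prod_def)
    then show ?thesis ..
  qed
qed

definition quadratic_ext :: "'f::field \<Rightarrow> 'f \<Rightarrow> ('f, 'f \<times> 'f) extension" where
  "quadratic_ext \<alpha> \<beta> =
     \<lparr>emult = comm_table (1, 0) (0, 1) (\<alpha>, \<beta>), eone = (1, 0), embed = (\<lambda>c. (c, 0))\<rparr>"

lemma P26_quadratic_ext: "P26 (quadratic_ext \<alpha> \<beta>) = quadratic_algebra \<alpha> \<beta>"
  by (simp add: P26_def quadratic_ext_def quadratic_algebra_def table_algebra_def ext_scal_def
      comm_table_def alt_table_def pair_scal_def fun_eq_iff zero_prod_def)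

text \<open>Inverses are conjugates divided by norms; the norm of a nonzero element \<open>x + yX\<close> does not
  vanish, since \<open>x\<^sup>2 + \<beta>xy - \<alpha>y\<^sup>2 = 0\<close> with \<open>y \<noteq> 0\<close> makes \<open>-x / y\<close> a root.\<close>

lemma quadratic_extension_quadratic_ext:
  assumes no_root: "\<And>r. r * r \<noteq> \<beta> * r + (\<alpha>::'f::field)"
  shows "quadratic_extension (quadratic_ext \<alpha> \<beta>)"
proof -
  let ?M = "comm_table (1, 0) (0, 1) (\<alpha>, \<beta>)"
  define N where "N v = fst v * fst v + \<beta> * fst v * snd v - \<alpha> * snd v * snd v" for v
  define iv where "iv v = pair_scal (1 / N v) (fst v + \<beta> * snd v, - snd v)" for v
  have N: "N v \<noteq> 0" if "v \<noteq> 0" for v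
  proof
    assume "N v = 0"
    show False
    proof (cases "snd v = 0")
      case True
      then show False
        using \<open>N v = 0\<close> \<open>v \<noteq> 0\<close> by (simp add: N_def prod_eq_iff)
    next
      case False
      have "(- fst v / snd v) * (- fst v / snd v) = \<beta> * (- fst v / snd v) + \<alpha>"
        using False \<open>N v = 0\<close> by (simp add: N_def field_simps)
      then show False
        using no_root by blast
    qed
  qed
  have inverse: "?M (iv v) v = (1, 0)" if "v \<noteq> 0" for v
  proof -
    have norm: "?M (pair_scal c (fst v + \<beta> * snd v, - snd v)) v = pair_scal c (N v, 0)" for c
      by (simp add: quadratic_mult pair_scal_def N_def algebra_simps)
    show ?thesis
      unfolding iv_def norm using N[OF that] by (simp add: pair_scal_def)
  qed
  have "class.field (\<lambda>v w. ?M v (iv w)) iv ?M (1, 0) (+) 0 (-) uminus"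
  proof unfold_locales
    show "?M (?M v w) z = ?M v (?M w z)" for v w z
      by (rule quadratic_mult_assoc)
    show "?M (iv v) v = (1, 0)" if "v \<noteq> 0" for v
      using that by (rule inverse)
    show "iv 0 = 0"
      by (simp add: iv_def pair_scal_def zero_prod_def)
  qed (auto simp: quadratic_mult zero_prod_def algebra_simps)
  then have "field_extension (quadratic_ext \<alpha> \<beta>)"
    unfolding field_extension_def
    by (auto simp: quadratic_ext_def quadratic_mult)
  moreover have "poisson_dim (P26 (quadratic_ext \<alpha> \<beta>)) = 2"
    by (simp add: P26_quadratic_ext quadratic_algebra_def poisson_dim_table_algebra)
  ultimately show ?thesis
    by (simp add: quadratic_extension_def poisson_dim_def P26_def)
qed


section \<open>Zero bracket and an idempotent\<close>

context poisson_plane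
begin

text \<open>In the basis \<open>e, f\<close> of eigenvectors of multiplication by \<open>e\<close>, the case \<open>ef = 0\<close> gives
  \<open>e f\<^sup>2 = 0\<close>, so \<open>f\<^sup>2\<close> is a multiple of \<open>f\<close>, and \<open>f\<close> can be rescaled to an idempotent unless
  its square is zero. If \<open>ef = f\<close> then \<open>e\<close> is an identity and only \<open>f\<^sup>2\<close> remains free.\<close>

lemma iso_with_idempotent:
  assumes brk: "\<And>x y. \<lbrace>x, y\<rbrace> = 0" and e: "e \<bullet> e = e" "e \<noteq> 0"
  shows "P \<simeq>\<^sub>P P23 \<or> P \<simeq>\<^sub>P P24 \<or> (\<exists>\<alpha> \<beta>. P \<simeq>\<^sub>P quadratic_algebra \<alpha> \<beta>)"
proof -
  \<comment> \<open>Multiplication by \<open>e\<close> is a projection that fixes \<open>e\<close>, so its image is the whole space or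
    the line of \<open>e\<close>; in the latter case \<open>f\<close> spans its kernel.\<close>
  obtain f where ind: "indep_pair P e f" and f: "e \<bullet> f = 0 \<or> e \<bullet> f = f"
  proof -
    obtain y where y: "indep_pair P e y"
      using indep_pair_extend[OF e(2)] by blast
    have eey: "e \<bullet> (e \<bullet> y) = e \<bullet> y"
      using prd_assoc[of e e y] e by simp
    show thesis
    proof (cases "indep_pair P e (e \<bullet> y)")
      case True
      then show thesis
        using that eey by blast
    next
      case False
      then obtain c where c: "e \<bullet> y = c \<cdot> e"
        using indep_pairI[OF e(2)] by blast
      have "indep_pair P e (y - c \<cdot> e)"
      proof (rule indep_pairI[OF e(2)])
        fix k
        show "y - c \<cdot> e \<noteq> k \<cdot> e"
        proof
          assume "y - c \<cdot> e = k \<cdot> e"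
          then have "- (k + c) \<cdot> e + 1 \<cdot> y = 0"
            by (simp add: algebra_simps scale_left_distrib)
          then show False
            using indep_pairD(2)[OF y] by fastforce
        qed
      qed
      moreover have "e \<bullet> (y - c \<cdot> e) = 0"
        by (simp add: prd_diff prd_scale c e)
      ultimately show thesis
        using that by blast
    qed
  qed
  obtain v where v: "f \<bullet> f = comb P e f v"
    using indep_pair_spans[OF ind] by metis
  from f show ?thesis
  proof
    assume ef: "e \<bullet> f = 0"
    have "e \<bullet> (f \<bullet> f) = 0"
      using prd_assoc[of e f f] ef by simp
    then have "fst v = 0"
      using v e ef by (simp add: comb_def prd_add prd_scale)
    then have ff: "f \<bullet> f = snd v \<cdot> f"
      using v by (simp add: comb_def)
    show ?thesis
    proof (cases "snd v = 0")
      case True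
      have "P \<simeq>\<^sub>P P23"
        unfolding P23_def
        by (rule iso_table_algebra[OF ind]) (simp_all add: comb_def e ef ff True brk)
      then show ?thesis ..
    next
      case False
      define g where "g = (1 / snd v) \<cdot> f"
      have "indep_pair P e g"
        unfolding indep_pair_def
      proof (intro allI impI)
        fix w
        assume "comb P e g w = 0"
        then have "fst w \<cdot> e + (snd w / snd v) \<cdot> f = 0"
          by (simp add: comb_def g_def)
        from indep_pairD[OF ind this] show "w = 0"
          using False by (simp add: prod_eq_iff)
      qed
      moreover have "g \<bullet> g = g" "e \<bullet> g = 0"
        using False by (simp_all add: g_def prd_scale ff ef)
      ultimately have "P \<simeq>\<^sub>P P24"
        unfolding P24_def
        by (intro iso_table_algebra[of e g]) (simp_all add: comb_def e brk)
      then show ?thesis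
        by blast
    qed
  next
    assume ef: "e \<bullet> f = f"
    have "P \<simeq>\<^sub>P quadratic_algebra (fst v) (snd v)"
      unfolding quadratic_algebra_def
      by (rule iso_table_algebra[OF ind]) (simp_all add: comb_def e ef brk v)
    then show ?thesis
      by blast
  qed
qed

end


section \<open>The classification\<close>

lemma poisson_plane_cases:
  fixes P :: "('f::field, 'p::ab_group_add) poisson"
  assumes "poisson_algebra P" "poisson_dim P = 2"
  shows "P \<simeq>\<^sub>P P21 \<or> P \<simeq>\<^sub>P P22 \<or> P \<simeq>\<^sub>P P23 \<or> P \<simeq>\<^sub>P P24 \<or> P \<simeq>\<^sub>P P25 \<or>
    (\<exists>K :: ('f, 'f \<times> 'f) extension. quadratic_extension K \<and> P \<simeq>\<^sub>P P26 K) \<or> P \<simeq>\<^sub>P P27"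
proof -
  interpret poisson_plane P
    using assms by (simp add: poisson_plane_def poisson_plane_axioms_def)
  have quadratic: "P \<simeq>\<^sub>P P24 \<or> P \<simeq>\<^sub>P P25 \<or>
      (\<exists>K :: ('f, 'f \<times> 'f) extension. quadratic_extension K \<and> P \<simeq>\<^sub>P P26 K)"
    if "P \<simeq>\<^sub>P quadratic_algebra \<alpha> \<beta>" for \<alpha> \<beta>
  proof (cases "\<exists>r. r * r = \<beta> * r + \<alpha>")
    case True
    then show ?thesis
      using quadratic_algebra_root poisson_iso_trans[OF that] by blast
  next
    case False
    then show ?thesis
      using quadratic_extension_quadratic_ext P26_quadratic_ext that by metis
  qed
  show ?thesis
  proof (cases "\<forall>x y. brk P x y = 0")
    case False
    then show ?thesis
      using iso_P27 by blast
  next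
    case True
    show ?thesis
    proof (cases "\<exists>e. prd P e e = e \<and> e \<noteq> 0")
      case idem: True
      then have "P \<simeq>\<^sub>P P23 \<or> P \<simeq>\<^sub>P P24 \<or> (\<exists>\<alpha> \<beta>. P \<simeq>\<^sub>P quadratic_algebra \<alpha> \<beta>)"
        using iso_with_idempotent True by blast
      then show ?thesis
        using quadratic by blast
    next
      case False
      then have "P \<simeq>\<^sub>P P21 \<or> P \<simeq>\<^sub>P P22"
        using iso_without_idempotent True by blast
      then show ?thesis
        by blast
    qed
  qed
qed

text \<open>Uniqueness comes from an invariant \<open>n\<close> that records the position of any entry that holds.\<close>

lemma exactly_oneI:
  assumes "True \<in> set bs" "\<And>i. i < length bs \<Longrightarrow> bs ! i \<Longrightarrow> n = i"
  shows "exactly_one bs"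
  using assms unfolding exactly_one_def in_set_conv_nth by metis

theorem theorem4p1:
  fixes P :: "('f::field, 'p::ab_group_add) poisson"
    and E :: "('f, 'e::ab_group_add) extension"
    and D :: "('f, 'd::ab_group_add) extension"
  shows
    "(poisson_algebra P \<and> poisson_dim P = 2 \<longrightarrow>
        exactly_one
          [P \<simeq>\<^sub>P P21, P \<simeq>\<^sub>P P22, P \<simeq>\<^sub>P P23, P \<simeq>\<^sub>P P24, P \<simeq>\<^sub>P P25,
           \<exists>K :: ('f, 'f \<times> 'f) extension. quadratic_extension K \<and> P \<simeq>\<^sub>P P26 K,
           P \<simeq>\<^sub>P P27] \<and>
        (quadratic_extension E \<and> quadratic_extension D \<and> P \<simeq>\<^sub>P P26 E \<and> P \<simeq>\<^sub>P P26 D \<longrightarrow>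
           E \<simeq>\<^sub>E D)) \<and>
     sorted_wrt (\<lambda>M N. \<not> M \<simeq>\<^sub>P N) [P21, P22, P23, P24, P25, P27 :: ('f, 'f \<times> 'f) poisson] \<and>
     (quadratic_extension E \<longrightarrow>
        (\<forall>M \<in> {P21, P22, P23, P24, P25, P27 :: ('f, 'f \<times> 'f) poisson}. \<not> P26 E \<simeq>\<^sub>P M)) \<and>
     (quadratic_extension E \<and> quadratic_extension D \<longrightarrow>
        (P26 E \<simeq>\<^sub>P P26 D \<longleftrightarrow> E \<simeq>\<^sub>E D))"
proof (intro conjI impI)
  assume P: "poisson_algebra P \<and> poisson_dim P = 2"
  let ?L = "[P \<simeq>\<^sub>P P21, P \<simeq>\<^sub>P P22, P \<simeq>\<^sub>P P23, P \<simeq>\<^sub>P P24, P \<simeq>\<^sub>P P25,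
    \<exists>K :: ('f, 'f \<times> 'f) extension. quadratic_extension K \<and> P \<simeq>\<^sub>P P26 K, P \<simeq>\<^sub>P P27]"
  have models: "P \<simeq>\<^sub>P P21 \<Longrightarrow> poisson_type P = 0" "P \<simeq>\<^sub>P P22 \<Longrightarrow> poisson_type P = 1"
    "P \<simeq>\<^sub>P P23 \<Longrightarrow> poisson_type P = 2" "P \<simeq>\<^sub>P P24 \<Longrightarrow> poisson_type P = 3"
    "P \<simeq>\<^sub>P P25 \<Longrightarrow> poisson_type P = 4" "P \<simeq>\<^sub>P P27 \<Longrightarrow> poisson_type P = 6"
    by (simp_all add: poisson_type_iso poisson_type_models)
  have field: "poisson_type P = 5" if "quadratic_extension K" "P \<simeq>\<^sub>P P26 K"
    for K :: "('f, 'f \<times> 'f) extension"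
    using that by (simp add: poisson_type_iso poisson_type_P26)
  have type: "poisson_type P = i" if "i < length ?L" "?L ! i" for i
  proof -
    have "i = 0 \<or> i = 1 \<or> i = 2 \<or> i = 3 \<or> i = 4 \<or> i = 5 \<or> i = 6"
      using \<open>i < length ?L\<close> by auto
    then show ?thesis
      using \<open>?L ! i\<close> by (elim disjE) (auto dest: models field simp del: One_nat_def)
  qed
  have "True \<in> set ?L"
    using poisson_plane_cases[OF conjunct1[OF P] conjunct2[OF P]]
    by (simp only: list.set insert_iff eq_commute[of True] eq_True empty_iff simp_thms)
  then show "exactly_one ?L"
    by (rule exactly_oneI) (rule type)
next
  assume "quadratic_extension E \<and> quadratic_extension D \<and> P \<simeq>\<^sub>P P26 E \<and> P \<simeq>\<^sub>P P26 D"
  then show "E \<simeq>\<^sub>E D"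
    using P26_iso_iff poisson_iso_sym poisson_iso_trans by blast
next
  show "sorted_wrt (\<lambda>M N. \<not> M \<simeq>\<^sub>P N) [P21, P22, P23, P24, P25, P27 :: ('f, 'f \<times> 'f) poisson]"
    by (auto dest!: poisson_type_iso simp: poisson_type_models)
next
  assume "quadratic_extension E"
  then show "\<forall>M \<in> {P21, P22, P23, P24, P25, P27 :: ('f, 'f \<times> 'f) poisson}. \<not> P26 E \<simeq>\<^sub>P M"
    by (auto dest!: poisson_type_iso simp: poisson_type_models poisson_type_P26)
next
  assume "quadratic_extension E \<and> quadratic_extension D"
  then show "P26 E \<simeq>\<^sub>P P26 D \<longleftrightarrow> E \<simeq>\<^sub>E D"
    by (simp add: P26_iso_iff)
qed

end
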